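(* Let $X$ be a nonempty set, $Y$ a nonempty subset of $X$, and $f,g\in\overline{\Omega}(X,Y)$. Then $(f,g)\in\mathcal{J}$ in $\overline{\Omega}(X,Y)$ if and only if $|Xf\setminus Y|=|Xg\setminus Y|$ and there exist partitions $\{P_y\colon y\in Y\}$ and $\{Q_y\colon y\in Y\}$ of $Y$ such that \[|y(f_{\upharpoonright Y})^{-1}|\geq\sum_{w\in P_y}|w(g_{\upharpoonright Y})^{-1}|\quad\text{and}\quad |y(g_{\upharpoonright Y})^{-1}|\geq\sum_{w\in Q_y}|w(f_{\upharpoonright Y})^{-1}|\] for all $y\in Y$.
   Context: $T(X)$ is the semigroup of all maps $X\to X$ under composition; maps are written on the right and composed from left to right, so $x(fg)=(xf)g$, and for $B\subseteq X$, $Bf=\{xf\colon x\in B\}$. Let $\overline{\Omega}(X,Y)=\{f\in T(X)\colon Yf=Y\}$, a subsemigroup of $T(X)$ containing the identity map. For $f\in\overline{\Omega}(X,Y)$, $f_{\upharpoonright Y}\colon Y\to Y$ denotes the (surjective) map that agrees with $f$ on $Y$, and for $y\in Y$, $y(f_{\upharpoonright Y})^{-1}=\{z\in Y\colon zf=y\}$. $|A|$ denotes the cardinality of $A$; sums and inequalities are of cardinal numbers. A partition $\{P_y\colon y\in Y\}$ of $Y$ is a family, indexed by $Y$, of pairwise disjoint nonempty subsets of $Y$ (for distinct indices) whose union is $Y$. $\mathcal{J}$ is Green's relation: for a semigroup $S$ with identity, $(a,b)\in\mathcal{J}$ iff $a=cbd$ and $b=c'ad'$ for some $c,d,c',d'\in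 S$. *)

theory Defs
  imports "HOL-Algebra.Group" "HOL-Library.Disjoint_Sets"
begin

text \<open>
  A map \<open>X \<rightarrow> X\<close> is an element of \<open>X \<rightarrow>\<^sub>E X\<close>, i.e. it is \<open>undefined\<close> outside \<open>X\<close>, so that
  equality of HOL functions is equality of maps on \<open>X\<close>.  Maps act on the right and are composed
  from left to right, whereas \<^term>\<open>compose X g f\<close> applies \<open>f\<close> first.
\<close>

definition full_transformation_monoid :: "'a set \<Rightarrow> ('a \<Rightarrow> 'a) monoid" where
  "full_transformation_monoid X =
    \<lparr>carrier = X \<rightarrow>\<^sub>E X, mult = (\<lambda>f g. compose X g f), one = (\<lambda>x\<in>X. x)\<rparr>"

definition Omega_bar :: "'a set \<Rightarrow> 'a set \<Rightarrow> ('a \<Rightarrow> 'a) monoid" where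
  "Omega_bar X Y = (full_transformation_monoid X)
    \<lparr>carrier := {f \<in> carrier (full_transformation_monoid X). f ` Y = Y}\<rparr>"

definition green_J :: "('a, 'b) monoid_scheme \<Rightarrow> ('a \<times> 'a) set" where
  "green_J S = {(a, b). a \<in> carrier S \<and> b \<in> carrier S \<and>
    (\<exists>c\<in>carrier S. \<exists>d\<in>carrier S. a = c \<otimes>\<^bsub>S\<^esub> b \<otimes>\<^bsub>S\<^esub> d) \<and>
    (\<exists>c\<in>carrier S. \<exists>d\<in>carrier S. b = c \<otimes>\<^bsub>S\<^esub> a \<otimes>\<^bsub>S\<^esub> d)}"

definition indexed_partition :: "('i \<Rightarrow> 'a set) \<Rightarrow> 'i set \<Rightarrow> 'a set \<Rightarrow> bool" where
  "indexed_partition P I A \<longleftrightarrow>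
    disjoint_family_on P I \<and> (\<forall>i\<in>I. P i \<noteq> {}) \<and> (\<Union>i\<in>I. P i) = A"

definition restr_fibre :: "('a \<Rightarrow> 'a) \<Rightarrow> 'a set \<Rightarrow> 'a \<Rightarrow> 'a set" where
  "restr_fibre f Y y = {z \<in> Y. restrict f Y z = y}"

lemma monoid_full_transformation_monoid: "monoid (full_transformation_monoid X)"
  by (rule monoidI)
    (auto simp: full_transformation_monoid_def compose_def fun_eq_iff PiE_iff extensional_def)

lemma submonoid_Omega_bar:
  assumes "Y \<subseteq> X"
  shows "submonoid (carrier (Omega_bar X Y)) (full_transformation_monoid X)"
proof
  show "carrier (Omega_bar X Y) \<subseteq> carrier (full_transformation_monoid X)"
    by (auto simp: Omega_bar_def)
  show "\<one>\<^bsub>full_transformation_monoid X\<^esub> \<in> carrier (Omega_bar X Y)"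
    using assms by (auto simp: Omega_bar_def full_transformation_monoid_def)
next
  fix f g
  assume fg: "f \<in> carrier (Omega_bar X Y)" "g \<in> carrier (Omega_bar X Y)"
  have "compose X g f ` Y = g ` (f ` Y)"
    unfolding image_image by (rule image_cong) (use assms in \<open>auto simp: compose_def\<close>)
  with fg show "f \<otimes>\<^bsub>full_transformation_monoid X\<^esub> g \<in> carrier (Omega_bar X Y)"
    by (auto simp: Omega_bar_def full_transformation_monoid_def compose_def PiE_iff)
qed

lemma monoid_Omega_bar: "Y \<subseteq> X \<Longrightarrow> monoid (Omega_bar X Y)"
  using submonoid.submonoid_is_monoid[OF submonoid_Omega_bar monoid_full_transformation_monoid]
  by (simp add: Omega_bar_def)

unbundle cardinal_syntax

end

theory Submission
  imports Defs
begin

text \<open>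
  The relation \<open>\<J>\<close> is the symmetric part of the divisibility preorder \<open>f = c g d\<close>, and the
  condition in the theorem splits in the same way: equality of \<open>|X f - Y|\<close> and \<open>|X g - Y|\<close> is two
  opposite inequalities, and the families \<open>P\<close> and \<open>Q\<close> are independent of each other.  So it is
  enough to show (lemma \<open>Omega_bar_factor_iff\<close>) that \<open>f\<close> factors as \<open>c g d\<close> iff
  \<open>|X f - Y| \<le> |X g - Y|\<close> and a partition \<open>P\<close> with its fibre inequality exists.

  The link between the two sides is \<open>P\<^sub>y = y d\<^sup>-\<^sup>1 \<inter> Y\<close>.  The sum over \<open>P\<^sub>y\<close> of the sizes of the fibres
  of \<open>g\<close> is the size of the fibre of \<open>g d\<close> over \<open>y\<close> (lemma \<open>csum_fibres\<close>), so the fibre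
  inequalities state that every fibre of \<open>f\<close> in \<open>Y\<close> can be mapped onto the corresponding fibre of
  \<open>g d\<close>; such surjections are exactly what \<open>c\<close> must provide on \<open>Y\<close>.  Outside \<open>Y\<close> the only
  obstruction is that \<open>d\<close> has to produce the points of \<open>X f - Y\<close> from points of \<open>X g - Y\<close>,
  because \<open>d\<close> maps \<open>Y\<close> into \<open>Y\<close>.
\<close>

section \<open>Products in the monoid\<close>

lemma Omega_bar_carrier_iff:
  "h \<in> carrier (Omega_bar X Y) \<longleftrightarrow> h \<in> X \<rightarrow>\<^sub>E X \<and> h ` Y = Y"
  by (simp add: Omega_bar_def full_transformation_monoid_def)

lemma Omega_bar_mult3_eq_iff:
  assumes "f \<in> carrier (Omega_bar X Y)" "c \<in> carrier (Omega_bar X Y)"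
  shows "f = c \<otimes>\<^bsub>Omega_bar X Y\<^esub> g \<otimes>\<^bsub>Omega_bar X Y\<^esub> d \<longleftrightarrow> (\<forall>x\<in>X. f x = d (g (c x)))"
proof -
  have "f \<in> extensional X" and "\<And>x. x \<in> X \<Longrightarrow> c x \<in> X"
    using assms by (auto simp: Omega_bar_carrier_iff PiE_iff)
  moreover have "c \<otimes>\<^bsub>Omega_bar X Y\<^esub> g \<otimes>\<^bsub>Omega_bar X Y\<^esub> d = compose X d (compose X g c)"
    by (simp add: Omega_bar_def full_transformation_monoid_def)
  moreover have "f = compose X d (compose X g c) \<longleftrightarrow>
      (\<forall>x\<in>X. f x = compose X d (compose X g c) x)"
    using extensionalityI[OF \<open>f \<in> extensional X\<close> compose_extensional] by auto
  ultimately show ?thesis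
    by (simp add: compose_eq)
qed

section \<open>Fibres and indexed partitions\<close>

lemma csum_fibres: "(CSUM w : |B|. |restr_fibre g Y w| ) =o |{z \<in> Y. g z \<in> B}|"
proof -
  have "bij_betw snd (SIGMA w : B. restr_fibre g Y w) {z \<in> Y. g z \<in> B}"
    by (rule bij_betw_byWitness[where f' = "\<lambda>z. (g z, z)"]) (auto simp: restr_fibre_def)
  then show ?thesis
    unfolding Csum_def Field_card_of by (rule card_of_ordIsoI)
qed

lemma csum_fibres_ordLeq_iff:
  "(CSUM w : |B|. |restr_fibre g Y w| ) \<le>o |restr_fibre f Y y| \<longleftrightarrow>
    |{z \<in> Y. g z \<in> B}| \<le>o |{z \<in> Y. f z = y}|"
proof -
  have "restr_fibre f Y y = {z \<in> Y. f z = y}"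
    by (auto simp: restr_fibre_def)
  then show ?thesis
    using ordIso_ordLeq_trans[OF csum_fibres] ordIso_ordLeq_trans[OF ordIso_symmetric[OF csum_fibres]]
    by auto
qed

lemma indexed_partition_fibres:
  assumes "d ` Y = Y"
  shows "indexed_partition (\<lambda>y. {w \<in> Y. d w = y}) Y Y"
proof -
  have "\<exists>w\<in>Y. d w = y" if "y \<in> Y" for y
    using assms that by (metis imageE)
  with assms show ?thesis
    by (auto simp: indexed_partition_def disjoint_family_on_def)
qed

text \<open>
  Take for \<open>d\<close> the map that sends each point to the index of its block.  This is well defined because
  the blocks are disjoint, and onto because no block is empty.
\<close>

lemma indexed_partition_eq_fibres:
  assumes "indexed_partition P Y Y"
  obtains d where "d ` Y = Y" "\<And>y. y \<in> Y \<Longrightarrow> P y = {w \<in> Y. d w = y}"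
proof -
  have disj: "disjoint_family_on P Y" and ne: "\<And>y. y \<in> Y \<Longrightarrow> P y \<noteq> {}"
    and un: "(\<Union>y\<in>Y. P y) = Y"
    using assms by (auto simp: indexed_partition_def)
  have "\<forall>w\<in>Y. \<exists>y. y \<in> Y \<and> w \<in> P y"
    using un by blast
  then obtain d where d: "\<And>w. w \<in> Y \<Longrightarrow> d w \<in> Y \<and> w \<in> P (d w)"
    by metis
  have fib: "P y = {w \<in> Y. d w = y}" if "y \<in> Y" for y
  proof
    show "P y \<subseteq> {w \<in> Y. d w = y}"
    proof
      fix w assume w: "w \<in> P y"
      then have "w \<in> Y" using un that by blast
      moreover have "d w = y"
        using disjoint_family_onD[OF disj, of "d w" y] d[OF \<open>w \<in> Y\<close>] w that by blast
      ultimately show "w \<in> {w \<in> Y. d w = y}" by simp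
    qed
  qed (use d in auto)
  have "y \<in> d ` Y" if "y \<in> Y" for y
    using ne[OF that] fib[OF that] by auto
  with d have "d ` Y = Y"
    by auto
  with fib show thesis
    by (intro that)
qed

section \<open>Factorisations and cardinal inequalities\<close>

text \<open>
  A factorisation restricts to \<open>Y\<close>, where \<open>c\<close> is onto: it therefore maps each fibre of \<open>f\<close> onto the
  fibre of \<open>g d\<close>.  Outside \<open>Y\<close>, a point of \<open>X f - Y\<close> is the image under \<open>d\<close> of a point of \<open>X g\<close>
  that cannot lie in \<open>Y\<close>.
\<close>

lemma factorisation_imp_cardinal_conditions:
  assumes c: "c ` X \<subseteq> X" "c ` Y = Y" and d: "d ` Y = Y" and "Y \<subseteq> X"
    and fac: "\<forall>x\<in>X. f x = d (g (c x))"
  shows "|f ` X - Y| \<le>o |g ` X - Y|"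
    and "|{z \<in> Y. g z \<in> {w \<in> Y. d w = y}}| \<le>o |{z \<in> Y. f z = y}|"
proof -
  have "f ` X - Y \<subseteq> d ` (g ` X - Y)"
  proof
    fix v assume "v \<in> f ` X - Y"
    then obtain x where x: "x \<in> X" "v = d (g (c x))" and "v \<notin> Y"
      using fac by auto
    then have "g (c x) \<notin> Y"
      using d by blast
    with x c(1) show "v \<in> d ` (g ` X - Y)"
      by blast
  qed
  then show "|f ` X - Y| \<le>o |g ` X - Y|"
    by (rule surj_imp_ordLeq)
  have "{z \<in> Y. g z \<in> {w \<in> Y. d w = y}} \<subseteq> c ` {z \<in> Y. f z = y}"
  proof
    fix z assume z: "z \<in> {z \<in> Y. g z \<in> {w \<in> Y. d w = y}}"
    then obtain u where "u \<in> Y" "z = c u"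
      using c(2) by blast
    with z fac \<open>Y \<subseteq> X\<close> show "z \<in> c ` {z \<in> Y. f z = y}"
      by auto
  qed
  then show "|{z \<in> Y. g z \<in> {w \<in> Y. d w = y}}| \<le>o |{z \<in> Y. f z = y}|"
    by (rule surj_imp_ordLeq)
qed

text \<open>
  The fibres of \<open>h\<close> over \<open>Y\<close> are nonempty, so the inequality gives a surjection from each fibre of
  \<open>f\<close> to the fibre of \<open>h\<close> over the same point.  The fibres of \<open>f\<close> are disjoint, so these
  surjections glue to one map \<open>c\<close>, and since the fibres of \<open>h\<close> cover \<open>Y\<close>, \<open>c\<close> is onto.
\<close>

lemma surjective_left_factor:
  assumes f: "f ` Y \<subseteq> Y" and h: "h ` Y = Y"
    and le: "\<And>y. y \<in> Y \<Longrightarrow> |{z \<in> Y. h z = y}| \<le>o |{z \<in> Y. f z = y}|"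
  obtains c where "c ` Y = Y" "\<And>z. z \<in> Y \<Longrightarrow> f z = h (c z)"
proof -
  have "\<exists>s. s ` {z \<in> Y. f z = y} = {z \<in> Y. h z = y}" if "y \<in> Y" for y
  proof -
    have "y \<in> h ` Y"
      by (simp add: h that)
    then have "{z \<in> Y. h z = y} \<noteq> {}"
      by auto
    then show ?thesis
      using le[OF that] by (rule iffD2[OF card_of_ordLeq2])
  qed
  then have "\<forall>y\<in>Y. \<exists>s. s ` {z \<in> Y. f z = y} = {z \<in> Y. h z = y}"
    by (rule ballI)
  from bchoice[OF this] obtain s
    where s: "\<And>y. y \<in> Y \<Longrightarrow> s y ` {z \<in> Y. f z = y} = {z \<in> Y. h z = y}"
    by (elim exE) (rule that, erule (1) bspec)
  define c where "c = (\<lambda>z. s (f z) z)"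
  have c: "c z \<in> Y \<and> h (c z) = f z" if "z \<in> Y" for z
  proof -
    have "f z \<in> Y"
      using f that by (simp add: image_subset_iff)
    moreover have "s (f z) z \<in> s (f z) ` {u \<in> Y. f u = f z}"
      using that by (intro imageI) simp
    ultimately have "s (f z) z \<in> {u \<in> Y. h u = f z}"
      by (simp only: s)
    then show ?thesis
      by (simp add: c_def)
  qed
  have "z \<in> c ` Y" if "z \<in> Y" for z
  proof -
    have "h z \<in> Y"
      using imageI[OF that, of h] by (simp add: h)
    moreover have "z \<in> {u \<in> Y. h u = h z}"
      using that by simp
    ultimately have "z \<in> s (h z) ` {u \<in> Y. f u = h z}"
      by (simp add: s)
    then obtain x where z: "z = s (h z) x" and x: "x \<in> {u \<in> Y. f u = h z}"
      by (rule imageE)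
    from x have "s (h z) x = c x" and "x \<in> Y"
      by (simp_all add: c_def)
    with z show ?thesis
      by (intro image_eqI[of z c x]) simp_all
  qed
  then have "Y \<subseteq> c ` Y"
    by (rule subsetI)
  moreover have "c ` Y \<subseteq> Y"
    using c by (simp add: image_subset_iff)
  ultimately have "c ` Y = Y"
    by (rule equalityI[rotated])
  then show thesis
    by (rule that) (simp add: c)
qed

text \<open>
  Extend \<open>d\<close> beyond \<open>Y\<close> by the inverse of an injection of \<open>X f - Y\<close> into \<open>X g - Y\<close>.  The resulting
  map \<open>e\<close> makes \<open>X f\<close> a subset of \<open>X g e\<close>, so preimages can be chosen freely for the points
  outside \<open>Y\<close>, while on \<open>Y\<close> the gluing of surjections between fibres keeps \<open>c\<close> onto.
\<close>

lemma cardinal_conditions_imp_factorisation: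
  assumes "Y \<subseteq> X" and f: "f ` X \<subseteq> X" "f ` Y = Y" and g: "g ` X \<subseteq> X" "g ` Y = Y"
    and rank: "|f ` X - Y| \<le>o |g ` X - Y|"
    and d: "d ` Y = Y"
    and fibres: "\<And>y. y \<in> Y \<Longrightarrow> |{z \<in> Y. d (g z) = y}| \<le>o |{z \<in> Y. f z = y}|"
  obtains c e where "c ` X \<subseteq> X" "c ` Y = Y" "e ` X \<subseteq> X" "e ` Y = Y"
    "\<forall>x\<in>X. f x = e (g (c x))"
proof -
  have dg: "(\<lambda>z. d (g z)) ` Y = Y"
    using d g(2) by (metis image_image)
  obtain b where b: "b ` Y = Y" "\<And>z. z \<in> Y \<Longrightarrow> f z = d (g (b z))"
    using surjective_left_factor[of f Y "\<lambda>z. d (g z)"] f(2) dg fibres by blast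
  obtain \<phi> where inj: "inj_on \<phi> (f ` X - Y)" and \<phi>: "\<phi> ` (f ` X - Y) \<subseteq> g ` X - Y"
    using rank unfolding card_of_ordLeq[symmetric] by blast
  (* Off Y and off the range of \<phi> any value in X would do; the point itself is in X. *)
  define e where "e = (\<lambda>x. if x \<in> Y then d x
    else if x \<in> \<phi> ` (f ` X - Y) then the_inv_into (f ` X - Y) \<phi> x else x)"
  have e\<phi>: "e (\<phi> u) = u" if "u \<in> f ` X - Y" for u
    using that \<phi> inj by (auto simp: e_def the_inv_into_f_f)
  have eY: "e ` Y = Y"
    using d by (simp add: e_def)
  have eX: "e ` X \<subseteq> X"
  proof
    fix v assume "v \<in> e ` X"
    then obtain x where x: "x \<in> X" "v = e x" by blast
    consider "x \<in> Y" | u where "u \<in> f ` X - Y" "x = \<phi> u" | "x \<notin> Y" "x \<notin> \<phi> ` (f ` X - Y)"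
      by blast
    then show "v \<in> X"
    proof cases
      case 1
      then show ?thesis using x eY \<open>Y \<subseteq> X\<close> by blast
    next
      case 2
      then show ?thesis using x e\<phi> f(1) by auto
    next
      case 3
      then show ?thesis using x by (simp add: e_def)
    qed
  qed
  have ex: "\<exists>u\<in>X. e (g u) = f x" if "x \<in> X" for x
  proof (cases "f x \<in> Y")
    case True
    then obtain u where "u \<in> Y" "d (g u) = f x"
      using dg by (metis imageE)
    then show ?thesis
      using g(2) \<open>Y \<subseteq> X\<close> by (auto simp: e_def intro!: bexI[of _ u])
  next
    case False
    with that have fx: "f x \<in> f ` X - Y" by blast
    then obtain u where "u \<in> X" "g u = \<phi> (f x)"
      using \<phi> by (metis DiffD1 image_eqI image_iff subsetD)
    then show ?thesis
      using e\<phi>[OF fx] by (metis (no_types))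
  qed
  then obtain a where a: "\<And>x. x \<in> X \<Longrightarrow> a x \<in> X \<and> e (g (a x)) = f x"
    by metis
  define c where "c = (\<lambda>x. if x \<in> Y then b x else a x)"
  have cY: "c ` Y = Y"
    using b(1) by (simp add: c_def)
  have "f x = e (g (c x))" if "x \<in> X" for x
  proof (cases "x \<in> Y")
    case True
    then have "g (b x) \<in> Y" using b(1) g(2) by blast
    with True show ?thesis by (simp add: c_def e_def b(2))
  next
    case False
    with a that show ?thesis by (simp add: c_def)
  qed
  moreover have "c ` X \<subseteq> X"
    using a b(1) \<open>Y \<subseteq> X\<close> by (auto simp: c_def)
  ultimately show thesis
    using cY eX eY by (intro that[of c e]) auto
qed

lemma Omega_bar_factor_iff:
  assumes "Y \<subseteq> X" and f: "f \<in> carrier (Omega_bar X Y)" and g: "g \<in> carrier (Omega_bar X Y)"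
  shows "(\<exists>c\<in>carrier (Omega_bar X Y). \<exists>d\<in>carrier (Omega_bar X Y).
      f = c \<otimes>\<^bsub>Omega_bar X Y\<^esub> g \<otimes>\<^bsub>Omega_bar X Y\<^esub> d) \<longleftrightarrow>
    |f ` X - Y| \<le>o |g ` X - Y| \<and>
    (\<exists>P. indexed_partition P Y Y \<and>
      (\<forall>y\<in>Y. (CSUM w : |P y|. |restr_fibre g Y w| ) \<le>o |restr_fibre f Y y| ))"
  (is "?factors \<longleftrightarrow> ?rank \<and> ?fibres")
proof
  assume ?factors
  then obtain c d where cd: "c \<in> carrier (Omega_bar X Y)" "d \<in> carrier (Omega_bar X Y)"
    and fac: "\<forall>x\<in>X. f x = d (g (c x))"
    using Omega_bar_mult3_eq_iff[OF f] by blast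
  have c: "c ` X \<subseteq> X" "c ` Y = Y" and d: "d ` Y = Y"
    using cd by (auto simp: Omega_bar_carrier_iff)
  note conditions = factorisation_imp_cardinal_conditions[OF c d \<open>Y \<subseteq> X\<close> fac]
  have ?fibres
    using indexed_partition_fibres[OF d] conditions(2)
    unfolding csum_fibres_ordLeq_iff by blast
  with conditions(1) show "?rank \<and> ?fibres" ..
next
  assume R: "?rank \<and> ?fibres"
  then obtain P where P: "indexed_partition P Y Y"
    and le: "\<And>y. y \<in> Y \<Longrightarrow> |{z \<in> Y. g z \<in> P y}| \<le>o |{z \<in> Y. f z = y}|"
    unfolding csum_fibres_ordLeq_iff by blast
  obtain d where d: "d ` Y = Y" and Pd: "\<And>y. y \<in> Y \<Longrightarrow> P y = {w \<in> Y. d w = y}"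
    using indexed_partition_eq_fibres[OF P] by blast
  have fX: "f ` X \<subseteq> X" "f ` Y = Y" and gX: "g ` X \<subseteq> X" "g ` Y = Y"
    using f g by (auto simp: Omega_bar_carrier_iff)
  have "{z \<in> Y. d (g z) = y} = {z \<in> Y. g z \<in> P y}" if "y \<in> Y" for y
    using gX(2) Pd[OF that] by auto
  then have "|{z \<in> Y. d (g z) = y}| \<le>o |{z \<in> Y. f z = y}|" if "y \<in> Y" for y
    using le that by simp
  then obtain c e where ce: "c ` X \<subseteq> X" "c ` Y = Y" "e ` X \<subseteq> X" "e ` Y = Y"
    and fac: "\<forall>x\<in>X. f x = e (g (c x))"
    using cardinal_conditions_imp_factorisation[OF \<open>Y \<subseteq> X\<close> fX gX _ d] R by blast
  have restr: "restrict h X \<in> carrier (Omega_bar X Y)" if "h ` X \<subseteq> X" "h ` Y = Y" for h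
  proof -
    have "restrict h X ` Y = h ` Y"
      using \<open>Y \<subseteq> X\<close> by (intro image_cong) auto
    with that show ?thesis by (auto simp: Omega_bar_carrier_iff)
  qed
  have "\<forall>x\<in>X. f x = restrict e X (g (restrict c X x))"
    using fac ce(1) gX(1) by (simp add: image_subset_iff)
  then show ?factors
    using Omega_bar_mult3_eq_iff[OF f restr[OF ce(1,2)]] restr[OF ce(1,2)] restr[OF ce(3,4)]
    by blast
qed

theorem theorem4p10:
  fixes X Y :: "'a set" and f g :: "'a \<Rightarrow> 'a"
  assumes "X \<noteq> {}" and "Y \<noteq> {}" and "Y \<subseteq> X"
    and "f \<in> carrier (Omega_bar X Y)" and "g \<in> carrier (Omega_bar X Y)"
  shows "(f, g) \<in> green_J (Omega_bar X Y) \<longleftrightarrow>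
    |f ` X - Y| =o |g ` X - Y| \<and>
    (\<exists>P Q :: 'a \<Rightarrow> 'a set. indexed_partition P Y Y \<and> indexed_partition Q Y Y \<and>
      (\<forall>y\<in>Y.
        (CSUM w : |P y|. |restr_fibre g Y w| ) \<le>o |restr_fibre f Y y| \<and>
        (CSUM w : |Q y|. |restr_fibre f Y w| ) \<le>o |restr_fibre g Y y| ))"
proof -
  have "(f, g) \<in> green_J (Omega_bar X Y) \<longleftrightarrow>
    (\<exists>c\<in>carrier (Omega_bar X Y). \<exists>d\<in>carrier (Omega_bar X Y).
      f = c \<otimes>\<^bsub>Omega_bar X Y\<^esub> g \<otimes>\<^bsub>Omega_bar X Y\<^esub> d) \<and>
    (\<exists>c\<in>carrier (Omega_bar X Y). \<exists>d\<in>carrier (Omega_bar X Y).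
      g = c \<otimes>\<^bsub>Omega_bar X Y\<^esub> f \<otimes>\<^bsub>Omega_bar X Y\<^esub> d)"
    using assms(4,5) by (simp add: green_J_def)
  then show ?thesis
    unfolding Omega_bar_factor_iff[OF assms(3,4,5)] Omega_bar_factor_iff[OF assms(3,5,4)]
      ordIso_iff_ordLeq ball_conj_distrib
    by (elim ssubst) (intro iffI; elim conjE exE; intro conjI exI; assumption)
qed

end
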